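(* Let $a>1$ and $b>1$ be integers, let $n=a+b-2$, and consider the 2-connected $(a,b)$-puzzle on $V=\{1,\dots,n\}$, i.e. the cycle set consisting of the two cycles $\alpha=(1\ 2\ \dots\ a)$ and $\beta=(a-1\ a\ a+1\ \dots\ n)$. Its configuration group $H=\langle\alpha,\beta\rangle\le S_n$ is: 1. isomorphic to $S_{n-1}=S_5$ if $a=b=4$; 2. the alternating group $A_n$ if both $a$ and $b$ are odd; 3. the symmetric group $S_n$ otherwise. Moreover, any permutation in $H$ can be generated in $O(n^2)$ shifts; that is, there is an absolute constant $K$ (independent of $a,b$) such that every element of $H$ is a product of at most $Kn^2$ factors, each of which is one of $\alpha,\alpha^{-1},\beta,\beta^{-1}$.
   Context: Permutations are written in cycle notation. A shift along a cycle $(v_1\ \dots\ v_j)$ corresponds to applying the permutation $(v_1\ \dots\ v_j)$ or its inverse to the tokens placed on the vertices of $V$. The configuration group of a cycle set is the subgroup of $S_n$ generated by the permutations corresponding to its cycles. $A_n$ denotes the group of even permutations and $S_n$ the group of all permutations of $\{1,\dots,n\}$. *)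

theory Defs
  imports "HOL-Algebra.Sym_Groups"
begin

definition puzzle_n :: "nat \<Rightarrow> nat \<Rightarrow> nat" where
  "puzzle_n a b = a + b - 2"

definition puzzle_alpha :: "nat \<Rightarrow> nat \<Rightarrow> nat" where
  "puzzle_alpha a = cycle_of_list [1..<Suc a]"

definition puzzle_beta :: "nat \<Rightarrow> nat \<Rightarrow> nat \<Rightarrow> nat" where
  "puzzle_beta a b = cycle_of_list [a - 1..<Suc (puzzle_n a b)]"

definition puzzle_group :: "nat \<Rightarrow> nat \<Rightarrow> (nat \<Rightarrow> nat) monoid" where
  "puzzle_group a b = subgroup_generated (sym_group (puzzle_n a b))
                        {puzzle_alpha a, puzzle_beta a b}"

definition puzzle_shifts :: "nat \<Rightarrow> nat \<Rightarrow> (nat \<Rightarrow> nat) set" where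
  "puzzle_shifts a b = {puzzle_alpha a, inv' (puzzle_alpha a), puzzle_beta a b, inv' (puzzle_beta a b)}"

definition word_prod :: "(nat \<Rightarrow> nat) list \<Rightarrow> nat \<Rightarrow> nat" where
  "word_prod ws = foldr (\<circ>) ws id"

end

theory Submission
  imports Defs
begin

text \<open>
  The product \<open>\<beta>\<^sup>-\<^sup>1 \<alpha>\<close> fixes \<open>a - 1\<close> and permutes the other points in a single cycle, so any
  ordered pair of points can be moved to any other one in \<open>O(n)\<close> shifts. The commutator of
  \<open>\<alpha>\<close> and \<open>\<beta>\<close> is \<open>(1 a+1)(a-1 a)\<close> for \<open>a, b \<ge> 3\<close>; unless \<open>a = b = 4\<close>, boundedly many shifts
  give a 3-cycle, either directly (\<open>a \<le> 3\<close> or \<open>b \<le> 3\<close>) or as the square of the product of two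
  conjugates of the commutator whose supports share exactly one point. Conjugating it gives
  a 3-cycle through every pair of points, and two such 3-cycles combine to an arbitrary 3-cycle, still
  in \<open>O(n)\<close> shifts. Every even permutation is a product of at most \<open>n\<close> 3-cycles, and one further
  shift reaches the odd ones when \<open>\<alpha>\<close> or \<open>\<beta>\<close> is odd.

  For \<open>a = b = 4\<close> the group acts by conjugation on five fixed-point-free involutions of six points
  (the synthemes of a total). The action is faithful, and its image contains the two generators of the
  \<open>(2, 5)\<close>-puzzle, whose group is already known to be the full symmetric group on five points.
\<close>

section \<open>Words and 3-cycles\<close>

lemma word_prod_Nil: "word_prod [] = id"
  by (simp add: word_prod_def)

lemma word_prod_Cons: "word_prod (g # ws) = g \<circ> word_prod ws"
  by (simp add: word_prod_def)

lemma word_prod_append: "word_prod (us @ vs) = word_prod us \<circ> word_prod vs"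
  by (induction us) (simp_all add: word_prod_def comp_assoc)

text \<open>The ball about the identity in the word metric. Carrying an explicit radius through
  every later membership yields generation and the length bound together.\<close>

definition word_ball :: "(nat \<Rightarrow> nat) set \<Rightarrow> nat \<Rightarrow> (nat \<Rightarrow> nat) set" where
  "word_ball S k = {word_prod ws | ws. set ws \<subseteq> S \<and> length ws \<le> k}"

lemma id_in_word_ball: "id \<in> word_ball S k"
  by (auto simp: word_ball_def word_prod_def intro!: exI[of _ "[]"])

lemma word_ball_gen: "g \<in> S \<Longrightarrow> g \<in> word_ball S 1"
  by (auto simp: word_ball_def word_prod_def intro!: exI[of _ "[g]"])

lemma word_ball_comp:
  assumes "p \<in> word_ball S i" "q \<in> word_ball S j"
  shows "p \<circ> q \<in> word_ball S (i + j)"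
proof -
  obtain us vs where "p = word_prod us" "set us \<subseteq> S" "length us \<le> i"
    "q = word_prod vs" "set vs \<subseteq> S" "length vs \<le> j"
    using assms by (auto simp: word_ball_def)
  then show ?thesis
    by (auto simp: word_ball_def word_prod_append intro!: exI[of _ "us @ vs"])
qed

lemma word_ball_mono: "p \<in> word_ball S i \<Longrightarrow> i \<le> j \<Longrightarrow> p \<in> word_ball S j"
  by (fastforce simp: word_ball_def)

lemma word_ball_funpow:
  assumes "p \<in> word_ball S i"
  shows "p ^^ k \<in> word_ball S (k * i)"
proof (induction k)
  case 0
  show ?case by (simp only: funpow.simps id_in_word_ball)
next
  case (Suc k)
  show ?case
    using word_ball_comp[OF assms Suc] by (simp only: funpow.simps mult_Suc)
qed

section \<open>Values, inverses and rotations of 3-cycles\<close>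

lemma cycle3_apply:
  assumes "distinct [x, y, z]"
  shows "cycle_of_list [x, y, z] x = y" "cycle_of_list [x, y, z] y = z"
    "cycle_of_list [x, y, z] z = x"
    "w \<notin> {x, y, z} \<Longrightarrow> cycle_of_list [x, y, z] w = w"
  using assms by (auto simp: transpose_def)

lemma cycle3_inv:
  assumes "distinct [x, y, z]"
  shows "inv' (cycle_of_list [x, y, z]) = cycle_of_list [z, y, x]"
  by (rule inv_unique_comp) (use assms in \<open>auto simp: transpose_def fun_eq_iff\<close>)

lemma cycle3_rotate: "distinct [x, y, z] \<Longrightarrow> cycle_of_list [y, z, x] = cycle_of_list [x, y, z]"
  by (auto simp: transpose_def fun_eq_iff)

text \<open>Closure under inverses lets a word be inverted letter by letter in reverse order, so
  inversion keeps the radius and conjugation by \<open>g\<close> adds only twice the radius of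
  \<open>g\<close>.\<close>

locale symmetric_generators =
  fixes S :: "(nat \<Rightarrow> nat) set" and n :: nat
  assumes permutes: "g \<in> S \<Longrightarrow> g permutes {1..n}"
    and inv_closed: "g \<in> S \<Longrightarrow> inv' g \<in> S"
begin

lemma word_ball_permutes:
  assumes "p \<in> word_ball S k"
  shows "p permutes {1..n}"
proof -
  have "word_prod ws permutes {1..n}" if "set ws \<subseteq> S" for ws
    using that
    by (induction ws) (simp_all only: word_prod_Nil word_prod_Cons permutes_id permutes permutes_compose
        insert_subset list.simps simp_thms)
  then show ?thesis
    using assms by (auto simp: word_ball_def)
qed

lemma word_ball_bij: "p \<in> word_ball S k \<Longrightarrow> bij p"
  using word_ball_permutes permutes_bij by blast

lemma word_ball_inv:
  assumes "p \<in> word_ball S k"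
  shows "inv' p \<in> word_ball S k"
proof -
  have "inv' (word_prod ws) \<in> word_ball S (length ws)" if "set ws \<subseteq> S" for ws
    using that
  proof (induction ws)
    case Nil
    then show ?case
      by (simp only: word_prod_Nil inv_id id_in_word_ball)
  next
    case (Cons g ws)
    then have ws: "inv' (word_prod ws) \<in> word_ball S (length ws)" and g: "g \<in> S"
      by auto
    have "word_prod ws \<in> word_ball S (length ws)"
      using Cons.prems by (auto simp: word_ball_def)
    then have "bij (word_prod ws)" "bij g"
      using word_ball_bij permutes[OF g] permutes_bij by auto
    then have "inv' (word_prod (g # ws)) = inv' (word_prod ws) \<circ> inv' g"
      by (simp only: word_prod_Cons o_inv_distrib)
    then show ?case
      using word_ball_comp[OF ws word_ball_gen[OF inv_closed[OF g]]]
      by (simp only: list.size add_0_right add_Suc_right One_nat_def)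
  qed
  moreover obtain ws where "p = word_prod ws" "set ws \<subseteq> S" "length ws \<le> k"
    using assms by (auto simp: word_ball_def)
  ultimately show ?thesis
    by (blast intro: word_ball_mono)
qed

lemma word_ball_conj:
  assumes "g \<in> word_ball S i" "p \<in> word_ball S j"
  shows "g \<circ> p \<circ> inv' g \<in> word_ball S (2 * i + j)"
  using word_ball_comp[OF word_ball_comp[OF assms] word_ball_inv[OF assms(1)]]
  by (rule word_ball_mono) simp

text \<open>Conjugation relabels the entries of a cycle, so one short 3-cycle spreads to wherever
  short words carry its points.\<close>

lemma word_ball_conj_cycle:
  assumes "g \<in> word_ball S i" "cycle_of_list [x, y, z] \<in> word_ball S j" "distinct [x, y, z]"
  shows "cycle_of_list [g x, g y, g z] \<in> word_ball S (2 * i + j)"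
proof -
  have "g \<circ> cycle_of_list [x, y, z] \<circ> inv' g = cycle_of_list (map g [x, y, z])"
    using assms(3) word_ball_bij[OF assms(1)] by (rule conjugation_of_cycle)
  then show ?thesis
    using word_ball_conj[OF assms(1,2)] by simp
qed

text \<open>The 3-cycles \<open>(x y t)\<close> and \<open>(y z s)\<close> generate the alternating group on the points involved, which
  contains \<open>(x y z)\<close>.\<close>

lemma all_cycle3_in_word_ball:
  assumes pair: "\<And>u v. u \<in> X \<Longrightarrow> v \<in> X \<Longrightarrow> u \<noteq> v \<Longrightarrow>
      \<exists>w. w \<noteq> u \<and> w \<noteq> v \<and> cycle_of_list [u, v, w] \<in> word_ball S m"
    and xyz: "x \<in> X" "y \<in> X" "z \<in> X" "distinct [x, y, z]"
  shows "cycle_of_list [x, y, z] \<in> word_ball S (7 * m)"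
proof -
  obtain t where t: "t \<noteq> x" "t \<noteq> y" "cycle_of_list [x, y, t] \<in> word_ball S m"
    using pair[of x y] xyz by auto
  obtain s where s: "s \<noteq> y" "s \<noteq> z" "cycle_of_list [y, z, s] \<in> word_ball S m"
    using pair[of y z] xyz by auto
  have dt: "distinct [x, y, t]" and ds: "distinct [y, z, s]"
    using t s xyz by auto
  have B: "cycle_of_list [cycle_of_list [y, z, s] x, cycle_of_list [y, z, s] y,
      cycle_of_list [y, z, s] t] \<in> word_ball S (2 * m + m)"
    using s(3) t(3) dt by (rule word_ball_conj_cycle)
  \<comment> \<open>If \<open>t = z\<close> or \<open>s = x\<close>, a given 3-cycle is already the
    target up to rotation. Apart from these, \<open>B\<close> is \<open>(x z y)\<close>, the inverse
    of the target, when \<open>t = s\<close>, and \<open>(x z t)\<close> when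
    \<open>t \<noteq> s\<close>. In the last case, conjugating \<open>(x y t)\<close> by
    \<open>(x z t)\<close> gives the inverse \<open>(z y x)\<close> at radius
    \<open>2 * (3 * m) + m\<close>; this is the source of the factor 7.\<close>
  consider "t = z" | "s = x" | "t \<noteq> z" "s \<noteq> x" "t = s" | "t \<noteq> z" "s \<noteq> x" "t \<noteq> s"
    by blast
  then show ?thesis
  proof cases
    case 1
    then show ?thesis using t(3) by (auto intro: word_ball_mono)
  next
    case 2
    then show ?thesis using s(3) cycle3_rotate[OF xyz(4)] by (auto intro: word_ball_mono)
  next
    case 3
    have "cycle_of_list [x, z, y] \<in> word_ball S (3 * m)"
      using B 3 xyz(4) ds by (simp add: cycle3_apply del: cycle_of_list.simps)
    then have "inv' (cycle_of_list [x, z, y]) \<in> word_ball S (3 * m)"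
      by (rule word_ball_inv)
    then have "cycle_of_list [y, z, x] \<in> word_ball S (3 * m)"
      using cycle3_inv[of x z y] xyz(4) by simp
    then show ?thesis
      using cycle3_rotate[OF xyz(4)] by (auto intro: word_ball_mono)
  next
    case 4
    have "cycle_of_list [y, z, s] t = t"
      using cycle3_apply(4)[OF ds] 4 dt by auto
    then have A: "cycle_of_list [x, z, t] \<in> word_ball S (3 * m)"
      using B 4 xyz(4) dt ds by (simp add: cycle3_apply del: cycle_of_list.simps)
    have "cycle_of_list [cycle_of_list [x, z, t] x, cycle_of_list [x, z, t] y,
      cycle_of_list [x, z, t] t] \<in> word_ball S (2 * (3 * m) + m)"
      using A t(3) dt by (rule word_ball_conj_cycle)
    then have "cycle_of_list [z, y, x] \<in> word_ball S (7 * m)"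
      using 4 xyz(4) dt by (simp add: cycle3_apply del: cycle_of_list.simps)
    then have "inv' (cycle_of_list [z, y, x]) \<in> word_ball S (7 * m)"
      by (rule word_ball_inv)
    then show ?thesis
      using cycle3_inv[of z y x] xyz(4) by simp
  qed
qed

text \<open>Induction on \<open>X\<close>: a 3-cycle with the same value as \<open>p\<close> at
  \<open>x\<close> is split off from \<open>p\<close>, and what remains is even and fixes
  \<open>x\<close>. Each point costs at most one 3-cycle.\<close>

lemma even_in_word_ball:
  assumes "finite X" and cyc: "\<And>x y z. x \<in> X \<Longrightarrow> y \<in> X \<Longrightarrow> z \<in> X \<Longrightarrow> distinct [x, y, z] \<Longrightarrow>
      cycle_of_list [x, y, z] \<in> word_ball S m"
    and "p permutes X" "evenperm p"
  shows "p \<in> word_ball S (card X * m)"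
  using assms
proof (induction X arbitrary: p rule: finite_induct)
  case empty
  then have "p = id"
    by (simp only: permutes_empty)
  then show ?case
    by (simp only: id_in_word_ball)
next
  case (insert x X)
  have even_in_ball: "q \<in> word_ball S (card X * m)" if "q permutes X" "evenperm q" for q
    by (rule insert.IH[OF _ that]) (rule insert.prems(1), auto)
  show ?case
  proof (cases "p x = x")
    case True
    then have "p permutes X"
      by (intro permutes_superset[OF insert.prems(2)]) auto
    then show ?thesis
      using even_in_ball[OF _ insert.prems(3)] insert.hyps by (auto intro: word_ball_mono)
  next
    case False
    let ?y = "p x"
    have y: "?y \<in> X"
      using False insert.prems(2) permutes_in_image[of p "insert x X" x] by auto
    \<comment> \<open>A third point exists because otherwise \<open>p\<close> would be the
      transposition of \<open>x\<close> and \<open>p x\<close>, which is odd.\<close>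
    have "\<exists>z \<in> X. z \<noteq> ?y"
    proof (rule ccontr)
      assume "\<not> ?thesis"
      then have "X = {?y}"
        using y by blast
      then have "p permutes {x, ?y}"
        using insert.prems(2) by auto
      then have "p = id \<or> p = transpose x ?y"
        by (simp only: permutes_doubleton_iff)
      moreover have "p \<noteq> id"
        using False by auto
      moreover have "p \<noteq> transpose x ?y"
        using False insert.prems(3) evenperm_swap[of x ?y] by metis
      ultimately show False
        by blast
    qed
    then obtain z where z: "z \<in> X" "z \<noteq> ?y"
      by blast
    have d: "distinct [x, ?y, z]"
      using z y False insert.hyps by auto
    let ?t = "cycle_of_list [x, ?y, z]"
    let ?q = "inv' ?t \<circ> p"
    have tball: "?t \<in> word_ball S m"
      by (rule insert.prems(1)[OF _ _ _ d]) (use y z in auto)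
    have tbij: "bij ?t"
      using word_ball_bij[OF tball] .
    have "?t permutes {x, ?y, z}"
      using cycle_permutes[of "[x, ?y, z]"] by simp
    then have t: "?t permutes insert x X"
      by (rule permutes_subset) (use y z in auto)
    have "?q x = x"
      unfolding comp_apply using bij_is_inj[OF tbij] cycle3_apply(1)[OF d] by (rule inv_f_eq)
    moreover have "?q permutes insert x X"
      using t insert.prems(2) by (intro permutes_compose permutes_inv) auto
    ultimately have q: "?q permutes X"
      using permutes_superset[of ?q "insert x X" X] by blast
    have "evenperm ?t"
      using d by (simp add: evenperm_comp evenperm_swap permutation_swap_id)
    moreover have "permutation ?t" "permutation p"
      using permutation_of_cycle insert.prems(2) insert.hyps(1)
      by (auto simp: permutation_permutes simp del: cycle_of_list.simps)
    ultimately have "evenperm ?q"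
      using insert.prems(3) by (simp add: evenperm_comp evenperm_inv permutation_inverse
          del: cycle_of_list.simps)
    then have "?q \<in> word_ball S (card X * m)"
      using even_in_ball q by blast
    then have "?t \<circ> ?q \<in> word_ball S (m + card X * m)"
      using tball word_ball_comp by blast
    moreover have "?t \<circ> ?q = p"
      unfolding comp_assoc[symmetric] using bij_is_surj[OF tbij] by (simp only: surj_iff id_comp)
    ultimately show ?thesis
      using insert.hyps by simp
  qed
qed

end

section \<open>Moves of the puzzle\<close>

lemma cycle_of_upt_apply:
  assumes "i \<le> j"
  shows "cycle_of_list [i..<Suc j] x = (if i \<le> x \<and> x < j then Suc x else if x = j then i else x)"
  using assms
proof (induction i rule: inc_induct)
  case base
  then show ?case by simp
next
  case (step i)
  have "[i..<Suc j] = i # Suc i # [Suc (Suc i)..<Suc j]" "[Suc i..<Suc j] = Suc i # [Suc (Suc i)..<Suc j]"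
    using step.hyps by (simp_all add: upt_conv_Cons del: upt_Suc)
  then have "cycle_of_list [i..<Suc j] x = transpose i (Suc i) (cycle_of_list [Suc i..<Suc j] x)"
    by (simp del: upt_Suc)
  then show ?case
    using step.hyps unfolding step.IH by (auto simp: transpose_def)
qed

lemma conj_two_transpositions:
  assumes "bij g"
  shows "g \<circ> (transpose x y \<circ> transpose u v) \<circ> inv' g
    = transpose (g x) (g y) \<circ> transpose (g u) (g v)"
proof
  fix z
  obtain w where "z = g w"
    using assms by (metis bij_pointE)
  then show "(g \<circ> (transpose x y \<circ> transpose u v) \<circ> inv' g) z
    = (transpose (g x) (g y) \<circ> transpose (g u) (g v)) z"
    using bij_is_inj[OF assms] by (auto simp: transpose_def inj_eq)
qed

text \<open>\<open>f \<circ> g\<close> is the 3-cycle \<open>(p t q)\<close> times the disjoint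
  involution \<open>(r s)(u v)\<close>. Squaring cancels the involution and leaves
  \<open>(p t q)\<close> squared, which is \<open>(p q t)\<close>.\<close>

lemma square_overlapping_transpositions:
  assumes "distinct [p, q, r, s, t, u, v]"
    and "f = transpose p q \<circ> transpose r s" "g = transpose p t \<circ> transpose u v"
  shows "(f \<circ> g) \<circ> (f \<circ> g) = cycle_of_list [p, q, t]"
proof
  fix x
  have ne: "distinct [v, u, t, s, r, q, p]"
    using assms(1) by auto
  consider "x = p" | "x = q" | "x = r" | "x = s" | "x = t" | "x = u" | "x = v"
    | "x \<notin> {p, q, r, s, t, u, v}"
    by blast
  then show "((f \<circ> g) \<circ> (f \<circ> g)) x = cycle_of_list [p, q, t] x"
    using assms(1) ne unfolding assms(2,3) by cases (simp_all add: transpose_def)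
qed

lemma puzzle_alpha_apply:
  "1 < a \<Longrightarrow> puzzle_alpha a x = (if 1 \<le> x \<and> x < a then x + 1 else if x = a then 1 else x)"
  unfolding puzzle_alpha_def by (simp add: cycle_of_upt_apply del: upt_Suc)

lemma puzzle_beta_apply:
  assumes "1 < b"
  shows "puzzle_beta a b x = (if a - 1 \<le> x \<and> x < puzzle_n a b then x + 1
    else if x = puzzle_n a b then a - 1 else x)"
proof -
  have "a - 1 \<le> puzzle_n a b"
    using assms by (simp add: puzzle_n_def)
  then show ?thesis
    unfolding puzzle_beta_def by (simp add: cycle_of_upt_apply del: upt_Suc)
qed

locale puzzle =
  fixes a b :: nat
  assumes a: "1 < a" and b: "1 < b"
begin

abbreviation "n \<equiv> puzzle_n a b"
abbreviation "\<alpha> \<equiv> puzzle_alpha a"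
abbreviation "\<beta> \<equiv> puzzle_beta a b"
abbreviation "W \<equiv> word_ball (puzzle_shifts a b)"

lemmas alpha_apply = puzzle_alpha_apply[OF a]
lemmas beta_apply = puzzle_beta_apply[OF b, of a]

lemma alpha_permutes: "\<alpha> permutes {1..n}"
  unfolding puzzle_alpha_def using cycle_permutes[of "[1..<Suc a]"]
  by (rule permutes_subset) (use b in \<open>auto simp: puzzle_n_def\<close>)

lemma beta_permutes: "\<beta> permutes {1..n}"
  unfolding puzzle_beta_def using cycle_permutes[of "[a - 1..<Suc n]"]
  by (rule permutes_subset) (use a in auto)

lemmas alpha_bij = permutes_bij[OF alpha_permutes]
lemmas beta_bij = permutes_bij[OF beta_permutes]

sublocale symmetric_generators "puzzle_shifts a b" n
proof
  fix g
  assume g: "g \<in> puzzle_shifts a b"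
  show "g permutes {1..n}"
    using g alpha_permutes beta_permutes permutes_inv unfolding puzzle_shifts_def by blast
  show "inv' g \<in> puzzle_shifts a b"
    using g inv_inv_eq[OF alpha_bij] inv_inv_eq[OF beta_bij] unfolding puzzle_shifts_def by auto
qed

section \<open>Transitivity on ordered pairs of points\<close>

lemma alpha_in_W: "\<alpha> \<in> W 1"
  and beta_in_W: "\<beta> \<in> W 1"
  by (rule word_ball_gen, simp add: puzzle_shifts_def)+

text \<open>Values of \<open>inv' \<beta> \<circ> \<alpha>\<close> are found as \<beta>-preimages,
  without a formula for the inverse. The next four lemmas trace its path
  \<open>1, ..., a - 2, n, n - 1, ..., a\<close> and its fixed point \<open>a - 1\<close>.\<close>

lemma inv_beta_alpha_eqI: "\<beta> y = \<alpha> x \<Longrightarrow> (inv' \<beta> \<circ> \<alpha>) x = y"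
  using inv_f_eq[OF bij_is_inj[OF beta_bij], of y "\<alpha> x"] by (simp only: comp_apply)

lemma inv_beta_alpha_less: "1 \<le> x \<Longrightarrow> x < a - 2 \<Longrightarrow> (inv' \<beta> \<circ> \<alpha>) x = x + 1"
  by (rule inv_beta_alpha_eqI) (use b in \<open>auto simp: alpha_apply beta_apply puzzle_n_def\<close>)

lemma inv_beta_alpha_wrap: "3 \<le> a \<Longrightarrow> (inv' \<beta> \<circ> \<alpha>) (a - 2) = n"
  by (rule inv_beta_alpha_eqI) (use b in \<open>auto simp: alpha_apply beta_apply puzzle_n_def\<close>)

lemma inv_beta_alpha_greater: "a \<le> x \<Longrightarrow> x < n \<Longrightarrow> (inv' \<beta> \<circ> \<alpha>) (x + 1) = x"
  by (rule inv_beta_alpha_eqI) (auto simp: alpha_apply beta_apply)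

lemma inv_beta_alpha_fix: "(inv' \<beta> \<circ> \<alpha>) (a - 1) = a - 1"
  by (rule inv_beta_alpha_eqI) (use a b in \<open>auto simp: alpha_apply beta_apply puzzle_n_def\<close>)

text \<open>The pivot \<open>a - 1\<close> lies on both cycles, so a power of \<alpha> suffices for
  points up to \<open>a\<close> and a power of \<beta> for the others.\<close>

lemma move_to_pivot:
  assumes "1 \<le> x" "x \<le> n"
  shows "\<exists>g \<in> W n. g x = a - 1"
proof (cases "x \<le> a")
  case True
  have up: "(\<alpha> ^^ k) y = y + k" if "1 \<le> y" "y + k \<le> a" for y k
    using that by (induction k) (auto simp: alpha_apply)
  show ?thesis
  proof (cases "x = a")
    case True
    \<comment> \<open>The point \<open>a\<close> lies just past the pivot, so \<alpha> first wraps
      it round to 1.\<close>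
    have "(\<alpha> ^^ (a - 2)) (\<alpha> x) = a - 1"
      using up[of 1 "a - 2"] a True by (simp add: alpha_apply)
    then have "(\<alpha> ^^ (a - 1)) x = a - 1"
      using a by (metis Suc_1 Suc_diff_Suc comp_apply funpow_Suc_right)
    moreover have "\<alpha> ^^ (a - 1) \<in> W n"
      by (rule word_ball_mono[OF word_ball_funpow[OF alpha_in_W]]) (use b in \<open>simp add: puzzle_n_def\<close>)
    ultimately show ?thesis by blast
  next
    case False
    have "(\<alpha> ^^ (a - 1 - x)) x = a - 1"
      using up[of x "a - 1 - x"] assms \<open>x \<le> a\<close> False by simp
    moreover have "\<alpha> ^^ (a - 1 - x) \<in> W n"
      by (rule word_ball_mono[OF word_ball_funpow[OF alpha_in_W]]) (use b in \<open>simp add: puzzle_n_def\<close>)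
    ultimately show ?thesis by blast
  qed
next
  case False
  have up: "(\<beta> ^^ k) x = x + k" if "x + k \<le> n" for k
    using that False by (induction k) (auto simp: beta_apply)
  have "(\<beta> ^^ Suc (n - x)) x = a - 1"
    using up[of "n - x"] assms by (simp add: beta_apply)
  moreover have "\<beta> ^^ Suc (n - x) \<in> W n"
    by (rule word_ball_mono[OF word_ball_funpow[OF beta_in_W]]) (use assms in simp)
  ultimately show ?thesis by blast
qed

text \<open>Powers of \<open>inv' \<beta> \<circ> \<alpha>\<close> stabilize the pivot and bring any
  other point to \<open>a\<close>. At most \<open>n\<close> steps of two shifts each are
  taken.\<close>

lemma move_fixing_pivot:
  assumes "1 \<le> x" "x \<le> n" "x \<noteq> a - 1"
  shows "\<exists>g \<in> W (2 * n). g (a - 1) = a - 1 \<and> g x = a"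
proof -
  let ?c = "inv' \<beta> \<circ> \<alpha>"
  have c: "?c \<in> W 2"
    using word_ball_comp[OF word_ball_inv[OF beta_in_W] alpha_in_W]
    by (simp only: one_add_one)
  have fix_pivot: "(?c ^^ k) (a - 1) = a - 1" for k
    by (induction k) (use inv_beta_alpha_fix in auto)
  have down: "(?c ^^ k) (a + k) = a" if "a + k \<le> n" for k
    using that
  proof (induction k)
    case 0
    show ?case by simp
  next
    case (Suc k)
    have "?c (a + Suc k) = a + k"
      using inv_beta_alpha_greater[of "a + k"] Suc.prems by simp
    then show ?case
      using Suc by (simp only: funpow_Suc_right comp_apply)
  qed
  have "\<exists>k \<le> n. (?c ^^ k) x = a"
  proof (cases "x < a")
    case False
    then show ?thesis
      using down[of "x - a"] assms by (intro exI[of _ "x - a"]) auto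
  next
    case True
    have up: "(?c ^^ k) x = x + k" if "x + k \<le> a - 2" for k
      using that
    proof (induction k)
      case 0
      show ?case by simp
    next
      case (Suc k)
      then have "?c (x + k) = x + Suc k"
        using inv_beta_alpha_less[of "x + k"] assms by simp
      then show ?case
        using Suc by (simp only: funpow.simps comp_apply add_leD1)
    qed
    have "x \<le> a - 2"
      using True assms by linarith
    then have "(?c ^^ Suc (a - 2 - x)) x = n"
      using up[of "a - 2 - x"] inv_beta_alpha_wrap assms(1) by simp
    moreover have "(?c ^^ (n - a)) n = a"
      using down[of "n - a"] a b by (simp add: puzzle_n_def)
    \<comment> \<open>The exponent counts \<open>a - 2 - x\<close> steps up to \<open>a - 2\<close>,
      one step to \<open>n\<close>, and \<open>n - a\<close> steps down to \<open>a\<close>.\<close>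
    ultimately have "(?c ^^ (n - a + Suc (a - 2 - x))) x = a"
      by (simp only: funpow_add comp_apply)
    then show ?thesis
      using assms \<open>x \<le> a - 2\<close> a b
      by (intro exI[of _ "n - a + Suc (a - 2 - x)"]) (auto simp: puzzle_n_def)
  qed
  then obtain k where "k \<le> n" "(?c ^^ k) x = a"
    by blast
  moreover from this have "?c ^^ k \<in> W (2 * n)"
    by (intro word_ball_mono[OF word_ball_funpow[OF c]]) simp
  ultimately show ?thesis
    using fix_pivot by blast
qed

text \<open>The first point goes to the pivot, then the second is moved inside the stabilizer of the
  pivot; the radii \<open>n\<close> and \<open>2 * n\<close> add up.\<close>

lemma move_pair:
  assumes "x \<in> {1..n}" "y \<in> {1..n}" "x \<noteq> y"
  shows "\<exists>g \<in> W (3 * n). g x = a - 1 \<and> g y = a"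
proof -
  obtain g where g: "g \<in> W n" "g x = a - 1"
    using move_to_pivot[of x] assms by auto
  have "g y \<in> {1..n}"
    using word_ball_permutes[OF g(1)] assms(2) permutes_in_image by metis
  moreover have "g y \<noteq> a - 1"
    using bij_is_inj[OF word_ball_bij[OF g(1)]] assms(3) g(2) by (metis injD)
  ultimately obtain h where h: "h \<in> W (2 * n)" "h (a - 1) = a - 1" "h (g y) = a"
    using move_fixing_pivot[of "g y"] by auto
  have "h \<circ> g \<in> W (3 * n)"
    by (rule word_ball_mono[OF word_ball_comp[OF h(1) g(1)]]) simp
  then show ?thesis
    using g h by (intro bexI[of _ "h \<circ> g"]) auto
qed

section \<open>The commutator and short 3-cycles\<close>

lemma commutator_in_W:
  assumes "3 \<le> a" "3 \<le> b"
  shows "transpose 1 (a + 1) \<circ> transpose (a - 1) a \<in> W 4"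
proof -
  let ?t = "transpose 1 (a + 1) \<circ> transpose (a - 1) a"
  \<comment> \<open>The commutator identity with its inverses moved to the other side, so that only
    values of \<alpha> and \<beta> have to be computed.\<close>
  have eq: "\<alpha> \<circ> \<beta> = ?t \<circ> (\<beta> \<circ> \<alpha>)"
  proof
    fix x
    \<comment> \<open>This substitution removes truncated subtraction; afterwards \<open>n\<close>
      is \<open>i + j + 4\<close>.\<close>
    obtain i j where ij: "a = i + 3" "b = j + 3"
      using assms by (metis le_add_diff_inverse2)
    have al: "\<alpha> y = (if 1 \<le> y \<and> y < i + 3 then y + 1 else if y = i + 3 then 1 else y)" for y
      unfolding alpha_apply by (simp add: ij)
    have be: "\<beta> y = (if i + 2 \<le> y \<and> y < i + j + 4 then y + 1 else if y = i + j + 4 then i + 2 else y)" for y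
      unfolding beta_apply by (simp add: ij puzzle_n_def)
    have t: "?t y = (if y = 1 then i + 4 else if y = i + 4 then 1
        else if y = i + 2 then i + 3 else if y = i + 3 then i + 2 else y)" for y
      unfolding ij by (simp add: transpose_def)
    \<comment> \<open>The case \<open>j = 0\<close> is separate because then \<open>a + 1\<close> is
      \<open>n\<close>, where \<beta> wraps round.\<close>
    consider "x = 0" | "1 \<le> x" "x \<le> i" | "x = i + 1" | "x = i + 2" | "x = i + 3" | "x = i + 4" "0 < j"
      | "x = i + 4" "j = 0" | "i + 4 < x" "x < i + j + 4" | "x = i + j + 4" "0 < j" | "i + j + 4 < x"
      by linarith
    then show "(\<alpha> \<circ> \<beta>) x = (?t \<circ> (\<beta> \<circ> \<alpha>)) x"
      unfolding comp_apply[of ?t] comp_apply[of \<alpha>] comp_apply[of \<beta>] t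
      by cases (simp_all add: al be)
  qed
  have "(\<beta> \<circ> \<alpha>) \<circ> inv' (\<beta> \<circ> \<alpha>) = id"
    using bij_is_surj[OF bij_comp[OF alpha_bij beta_bij]] by (simp only: surj_iff)
  then have "?t = (\<alpha> \<circ> \<beta>) \<circ> inv' (\<beta> \<circ> \<alpha>)"
    by (simp only: eq comp_assoc[of ?t] comp_id)
  moreover have "(\<alpha> \<circ> \<beta>) \<circ> inv' (\<beta> \<circ> \<alpha>) \<in> W (1 + 1 + (1 + 1))"
    by (intro word_ball_comp word_ball_inv alpha_in_W beta_in_W)
  ultimately show ?thesis
    by (simp only: one_add_one numeral_plus_numeral add_num_simps)
qed

lemma conj_commutator_in_W:
  assumes "3 \<le> a" "3 \<le> b" "g \<in> W 3"
  shows "transpose (g 1) (g (a + 1)) \<circ> transpose (g (a - 1)) (g a) \<in> W 10"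
  using word_ball_conj[OF assms(3) commutator_in_W[OF assms(1,2)]]
  by (simp only: conj_two_transpositions[OF word_ball_bij[OF assms(3)]]) simp

text \<open>The 3-cycle is the square of a product of two words of length at most 10, hence the
  radius 40.\<close>

lemma cycle3_if_overlap:
  assumes "transpose p q \<circ> transpose r s \<in> W 10" "transpose p t \<circ> transpose u v \<in> W 10"
    "distinct [p, q, r, s, t, u, v]" "{p, q, t} \<subseteq> {1..n}"
  shows "\<exists>x y z. {x, y, z} \<subseteq> {1..n} \<and> distinct [x, y, z] \<and> cycle_of_list [x, y, z] \<in> W 40"
proof (intro exI conjI)
  note fg = word_ball_comp[OF assms(1,2)]
  have "cycle_of_list [p, q, t] \<in> W (10 + 10 + (10 + 10))"
    unfolding square_overlapping_transpositions[OF assms(3) refl refl, symmetric]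
    by (rule word_ball_comp[OF fg fg])
  then show "cycle_of_list [p, q, t] \<in> W 40"
    by (simp del: cycle_of_list.simps)
qed (use assms(3,4) in auto)

lemma ex_cycle3:
  assumes "\<not> (a = 2 \<and> b = 2)" "\<not> (a = 4 \<and> b = 4)"
  shows "\<exists>x y z. {x, y, z} \<subseteq> {1..n} \<and> distinct [x, y, z] \<and> cycle_of_list [x, y, z] \<in> W 40"
proof -
  have alpha3: "\<alpha> ^^ 3 \<in> W 3" and beta3: "\<beta> ^^ 3 \<in> W 3"
    using word_ball_funpow[OF alpha_in_W, of 3] word_ball_funpow[OF beta_in_W, of 3]
    by (simp_all only: mult_1_right)
  have alpha1: "\<alpha> \<in> W 3" and beta1: "\<beta> \<in> W 3"
    by (rule word_ball_mono[OF alpha_in_W], simp, rule word_ball_mono[OF beta_in_W], simp)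
  have funpow_3: "(f ^^ 3) x = f (f (f x))" for f :: "nat \<Rightarrow> nat" and x
    by (simp add: numeral_3_eq_3)
  have comm: "transpose 1 (a + 1) \<circ> transpose (a - 1) a \<in> W 10" if "3 \<le> a" "3 \<le> b"
    by (rule word_ball_mono[OF commutator_in_W[OF that]]) simp
  consider "a = 2" "3 \<le> b" | "b = 2" "3 \<le> a" | "a = 3" "3 \<le> b" | "b = 3" "3 \<le> a"
    | "6 \<le> a" "3 \<le> b" | "6 \<le> b" "3 \<le> a" | "a = 5" "4 \<le> b" | "b = 5" "4 \<le> a"
  proof -
    have "a = 2 \<or> a = 3 \<or> a = 4 \<or> a = 5 \<or> 6 \<le> a" "b = 2 \<or> b = 3 \<or> b = 4 \<or> b = 5 \<or> 6 \<le> b"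
      using a b by linarith+
    then show ?thesis
      using assms that by (elim disjE) simp_all
  qed
  then show ?thesis
  proof cases
    case 1
    \<comment> \<open>Here \<alpha> is a transposition. Its conjugate by \<beta> shares one point
      with it, so their product is a 3-cycle; the case \<open>b = 2\<close> is the mirror
      image.\<close>
    have eq: "\<alpha> = transpose 1 2"
      using 1 by (auto simp: fun_eq_iff puzzle_alpha_apply transpose_def)
    have "\<beta> \<circ> transpose 1 2 \<circ> inv' \<beta> = transpose (\<beta> 1) (\<beta> 2)"
      using conjugation_of_cycle[OF _ beta_bij, of "[1, 2]"] by simp
    also have "\<dots> = transpose 2 3"
      using 1 by (simp add: puzzle_beta_apply puzzle_n_def eval_nat_numeral)
    finally have "cycle_of_list [1, 2, 3] = \<alpha> \<circ> (\<beta> \<circ> \<alpha> \<circ> inv' \<beta>)"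
      using eq by simp
    then have "cycle_of_list [1, 2, 3] \<in> W (1 + (2 * 1 + 1))"
      using word_ball_comp[OF alpha_in_W word_ball_conj[OF beta_in_W alpha_in_W]]
      by (simp only:)
    then have "cycle_of_list [1, 2, 3] \<in> W 40"
      by (rule word_ball_mono) simp
    then show ?thesis
      using 1 by (intro exI[of _ 1] exI[of _ 2] exI[of _ 3] conjI) (auto simp: puzzle_n_def)
  next
    case 2
    have eq: "\<beta> = transpose (a - 1) a"
      using 2 by (auto simp: fun_eq_iff puzzle_beta_apply transpose_def puzzle_n_def)
    have "\<alpha> \<circ> transpose (a - 1) a \<circ> inv' \<alpha> = transpose (\<alpha> (a - 1)) (\<alpha> a)"
      using conjugation_of_cycle[OF _ alpha_bij, of "[a - 1, a]"] 2 by simp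
    also have "\<dots> = transpose a 1"
      using 2 by (auto simp: puzzle_alpha_apply)
    finally have "cycle_of_list [a - 1, a, 1] = \<beta> \<circ> (\<alpha> \<circ> \<beta> \<circ> inv' \<alpha>)"
      using eq by simp
    then have "cycle_of_list [a - 1, a, 1] \<in> W (1 + (2 * 1 + 1))"
      using word_ball_comp[OF beta_in_W word_ball_conj[OF alpha_in_W beta_in_W]]
      by (simp only:)
    then have "cycle_of_list [a - 1, a, 1] \<in> W 40"
      by (rule word_ball_mono) simp
    then show ?thesis
      using 2 by (intro exI[of _ "a - 1"] exI[of _ a] exI[of _ 1] conjI) (auto simp: puzzle_n_def)
  next
    case 3
    have "\<alpha> = cycle_of_list [1, 2, 3]"
      using 3 by (simp add: puzzle_alpha_def upt_rec numeral_eq_Suc)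
    then have "cycle_of_list [1, 2, 3] \<in> W 40"
      using word_ball_mono[OF alpha_in_W, of 40] by simp
    then show ?thesis
      using 3 by (intro exI[of _ 1] exI[of _ 2] exI[of _ 3] conjI) (auto simp: puzzle_n_def)
  next
    case 4
    have "[a - 1..<Suc n] = [a - 1, a, a + 1]"
      using 4 by (simp add: puzzle_n_def upt_rec)
    then have "\<beta> = cycle_of_list [a - 1, a, a + 1]"
      by (simp only: puzzle_beta_def)
    then have "cycle_of_list [a - 1, a, a + 1] \<in> W 40"
      using word_ball_mono[OF beta_in_W, of 40] by simp
    then show ?thesis
      using 4 by (intro exI[of _ "a - 1"] exI[of _ a] exI[of _ "a + 1"] conjI) (auto simp: puzzle_n_def)
  next
    case 5
    \<comment> \<open>Conjugation by \<open>\<alpha> ^^ 3\<close> turns the commutator into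
      \<open>(4 a+1)(2 3)\<close>. As \<open>6 \<le> a\<close>, only \<open>a + 1\<close> is shared
      with the commutator.\<close>
    have ab: "3 \<le> a" "3 \<le> b"
      and "\<alpha> 1 = 2" "\<alpha> 2 = 3" "\<alpha> 3 = 4" "\<alpha> (a - 1) = a" "\<alpha> a = 1" "\<alpha> (a + 1) = a + 1"
      using 5 by (simp_all add: alpha_apply)
    then have "transpose 4 (a + 1) \<circ> transpose 2 3 \<in> W 10"
      using conj_commutator_in_W[OF ab alpha3] by (simp only: funpow_3)
    then have "transpose (a + 1) 4 \<circ> transpose 2 3 \<in> W 10"
      by (simp only: transpose_commute)
    moreover have "transpose (a + 1) 1 \<circ> transpose (a - 1) a \<in> W 10"
      using comm 5 by (simp add: transpose_commute)
    ultimately show ?thesis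
      using 5 by (intro cycle3_if_overlap[of "a + 1" 1 "a - 1" a 4 2 3]) (auto simp: puzzle_n_def)
  next
    case 6
    \<comment> \<open>Conjugation by \<open>\<beta> ^^ 3\<close> gives
      \<open>(1 a+4)(a+2 a+3)\<close>; \<open>6 \<le> b\<close> leaves room for
      \<open>a + 4\<close>, and only 1 is shared.\<close>
    have ab: "3 \<le> a" "3 \<le> b"
      and "\<beta> 1 = 1" "\<beta> (a - 1) = a" "\<beta> a = a + 1" "\<beta> (a + 1) = a + 2" "\<beta> (a + 2) = a + 3"
        "\<beta> (a + 3) = a + 4"
      using 6 by (auto simp: beta_apply puzzle_n_def)
    then have "transpose 1 (a + 4) \<circ> transpose (a + 2) (a + 3) \<in> W 10"
      using conj_commutator_in_W[OF ab beta3] by (simp only: funpow_3)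
    then show ?thesis
      using 6 comm by (intro cycle3_if_overlap[of 1 "a + 1" "a - 1" a "a + 4" "a + 2" "a + 3"])
        (auto simp: puzzle_n_def)
  next
    case 7
    \<comment> \<open>For \<open>a = 5\<close> this conjugate meets the commutator
      \<open>(1 6)(4 5)\<close> in both 4 and 6. Comparing it with the conjugate by \<beta> instead
      leaves 6 as the only common point.\<close>
    have "transpose 4 6 \<circ> transpose 2 3 \<in> W 10"
      using conj_commutator_in_W[OF _ _ alpha3] 7 by (simp add: puzzle_alpha_apply numeral_eq_Suc)
    moreover have "transpose 1 7 \<circ> transpose 5 6 \<in> W 10"
      using conj_commutator_in_W[OF _ _ beta1] 7 by (simp add: puzzle_beta_apply puzzle_n_def)
    moreover have "transpose 1 7 \<circ> transpose 5 6 = transpose 6 5 \<circ> transpose 1 (7::nat)"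
      by (auto simp: fun_eq_iff transpose_def)
    ultimately show ?thesis
      using 7 by (intro cycle3_if_overlap[of 6 4 2 3 5 1 7]) (auto simp: puzzle_n_def transpose_commute)
  next
    case 8
    \<comment> \<open>For \<open>b = 5\<close> the conjugates by \<open>\<beta> ^^ 3\<close> and by
      \<alpha> are used; they meet only in 1.\<close>
    have n: "n = a + 3"
      using 8 by (simp add: puzzle_n_def)
    have ab: "3 \<le> a" "3 \<le> b"
      using 8 by auto
    have "\<beta> 1 = 1" "\<beta> (a - 1) = a" "\<beta> a = a + 1" "\<beta> (a + 1) = a + 2" "\<beta> (a + 2) = a + 3"
        "\<beta> (a + 3) = a - 1"
      using 8 unfolding beta_apply n by simp_all
    then have "transpose 1 (a - 1) \<circ> transpose (a + 2) (a + 3) \<in> W 10"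
      using conj_commutator_in_W[OF ab beta3] by (simp only: funpow_3)
    moreover have "\<alpha> 1 = 2" "\<alpha> (a - 1) = a" "\<alpha> a = 1" "\<alpha> (a + 1) = a + 1"
      using 8 by (simp_all add: alpha_apply)
    then have "transpose 2 (a + 1) \<circ> transpose a 1 \<in> W 10"
      using conj_commutator_in_W[OF ab alpha1] by (simp only:)
    moreover have "transpose 2 (a + 1) \<circ> transpose a 1 = transpose 1 a \<circ> transpose 2 (a + 1)"
      using 8 by (auto simp: fun_eq_iff transpose_def)
    ultimately show ?thesis
      using 8 by (intro cycle3_if_overlap[of 1 "a - 1" "a + 2" "a + 3" a 2 "a + 1"])
        (auto simp: puzzle_n_def)
  qed
qed

end

section \<open>Parity and quadratic word length\<close>

lemma evenperm_cycle_of_list: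
  "distinct cs \<Longrightarrow> cs \<noteq> [] \<Longrightarrow> evenperm (cycle_of_list cs) \<longleftrightarrow> odd (length cs)"
proof (induction cs rule: cycle_of_list.induct)
  case (1 i j cs)
  have "evenperm (cycle_of_list (i # j # cs)) \<longleftrightarrow> (evenperm (transpose i j) \<longleftrightarrow> evenperm (cycle_of_list (j # cs)))"
    unfolding cycle_of_list.simps(1)
    by (rule evenperm_comp[OF permutation_swap_id permutation_of_cycle])
  then show ?case
    using 1 by (simp add: evenperm_swap del: cycle_of_list.simps)
qed (simp_all add: evenperm_id)

context puzzle
begin

text \<open>A 3-cycle of radius 40, conjugated by a word of length at most \<open>6 * n\<close>, has
  radius \<open>12 * n + 40\<close>. Combining two of these costs the factor 7, and at most
  \<open>n\<close> 3-cycles are multiplied.\<close>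

lemma even_in_W:
  assumes "\<not> (a = 4 \<and> b = 4)" "p permutes {1..n}" "evenperm p"
  shows "p \<in> W (n * (7 * (12 * n + 40)))"
\<comment> \<open>With only two points there is no 3-cycle, and the identity is the only even
  permutation.\<close>
proof (cases "a = 2 \<and> b = 2")
  case True
  then have "{1..n} = {1, 2}"
    by (auto simp: puzzle_n_def)
  then have "p = id \<or> p = transpose 1 2"
    using assms(2) by (simp only: permutes_doubleton_iff)
  moreover have "p \<noteq> transpose 1 2"
    using assms(3) evenperm_swap[of 1 "2::nat"] by auto
  ultimately show ?thesis
    using id_in_word_ball by blast
next
  case False
  obtain x y z where xyz: "{x, y, z} \<subseteq> {1..n}" "distinct [x, y, z]" "cycle_of_list [x, y, z] \<in> W 40"
    using ex_cycle3[OF False assms(1)] by blast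
  have pair: "\<exists>w. w \<noteq> u \<and> w \<noteq> v \<and> cycle_of_list [u, v, w] \<in> W (12 * n + 40)"
    if uv: "u \<in> {1..n}" "v \<in> {1..n}" "u \<noteq> v" for u v
  proof -
    obtain g where g: "g \<in> W (3 * n)" "g u = a - 1" "g v = a"
      using move_pair[OF uv] by blast
    obtain h where h: "h \<in> W (3 * n)" "h x = a - 1" "h y = a"
      using move_pair[of x y] xyz by auto
    \<comment> \<open>Both pairs are sent to \<open>(a - 1, a)\<close>, so \<open>?k\<close> takes
      \<open>(x, y)\<close> to \<open>(u, v)\<close>; the image of \<open>z\<close> may be any
      remaining point.\<close>
    let ?k = "inv' g \<circ> h"
    have inj: "inj g" "inj h"
      using g(1) h(1) word_ball_bij bij_is_inj by blast+
    have k: "?k x = u" "?k y = v"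
      using inv_f_f[OF inj(1), of u] inv_f_f[OF inj(1), of v] unfolding comp_apply g(2,3) h(2,3) .
    have kW: "?k \<in> W (3 * n + 3 * n)"
      using word_ball_comp[OF word_ball_inv[OF g(1)] h(1)] .
    have "?k z \<noteq> ?k x" "?k z \<noteq> ?k y"
      using inj_eq[OF bij_is_inj[OF word_ball_bij[OF kW]]] xyz(2) by auto
    moreover have "cycle_of_list [?k x, ?k y, ?k z] \<in> W (12 * n + 40)"
      using word_ball_conj_cycle[OF kW xyz(3,2)] by (rule word_ball_mono) simp
    ultimately show ?thesis
      unfolding k by blast
  qed
  have "cycle_of_list [x, y, z] \<in> W (7 * (12 * n + 40))"
    if "x \<in> {1..n}" "y \<in> {1..n}" "z \<in> {1..n}" "distinct [x, y, z]" for x y z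
    using pair that by (rule all_cycle3_in_word_ball)
  then have "p \<in> W (card {1..n} * (7 * (12 * n + 40)))"
    using assms(2,3) by (intro even_in_word_ball finite_atLeastAtMost)
  then show ?thesis
    by simp
qed

lemma alpha_even_iff: "evenperm \<alpha> \<longleftrightarrow> odd a"
  unfolding puzzle_alpha_def using a by (subst evenperm_cycle_of_list) auto

lemma beta_even_iff: "evenperm \<beta> \<longleftrightarrow> odd b"
proof -
  have "length [a - 1..<Suc n] = b" "[a - 1..<Suc n] \<noteq> []"
    using a b by (auto simp: puzzle_n_def)
  then show ?thesis
    unfolding puzzle_beta_def using evenperm_cycle_of_list[of "[a - 1..<Suc n]"] by simp
qed

text \<open>Some shift is odd; composing an odd permutation with its inverse reduces to the even
  case at the cost of one shift.\<close>

lemma perm_in_W: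
  assumes "\<not> (a = 4 \<and> b = 4)" "\<not> (odd a \<and> odd b)" "p permutes {1..n}"
  shows "p \<in> W (n * (7 * (12 * n + 40)) + 1)"
proof (cases "evenperm p")
  case True
  then show ?thesis
    by (intro word_ball_mono[OF even_in_W[OF assms(1,3)]]) auto
next
  case False
  obtain g where g: "g \<in> W 1" "g permutes {1..n}" "\<not> evenperm g"
    using assms(2) alpha_even_iff beta_even_iff alpha_in_W beta_in_W alpha_permutes beta_permutes by blast
  have perm: "permutation p" "permutation g"
    using assms(3) g(2) by (auto simp: permutation_permutes)
  have "evenperm (p \<circ> inv' g)"
    using False g(3) perm by (simp only: evenperm_comp evenperm_inv permutation_inverse)
  moreover have "p \<circ> inv' g permutes {1..n}"
    using permutes_compose[OF permutes_inv[OF g(2)] assms(3)] .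
  ultimately have "p \<circ> inv' g \<in> W (n * (7 * (12 * n + 40)))"
    by (intro even_in_W[OF assms(1)])
  then have "p \<circ> inv' g \<circ> g \<in> W (n * (7 * (12 * n + 40)) + 1)"
    using g(1) word_ball_comp by blast
  then show ?thesis
    by (simp only: comp_assoc permutes_inv_o(2)[OF g(2)] comp_id)
qed

section \<open>The group as the union of its word balls\<close>

lemma carrier_puzzle_group: "carrier (puzzle_group a b) = generate (sym_group n) {\<alpha>, \<beta>}"
  unfolding puzzle_group_def carrier_subgroup_generated
  using alpha_permutes beta_permutes by (simp add: sym_group_carrier Int_absorb1)

lemma W_subset_carrier:
  assumes "p \<in> W k"
  shows "p \<in> carrier (puzzle_group a b)"
proof -
  let ?H = "generate (sym_group n) {\<alpha>, \<beta>}"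
  have gens: "g \<in> ?H" if "g \<in> puzzle_shifts a b" for g
  proof -
    have "inv\<^bsub>sym_group n\<^esub> \<alpha> \<in> ?H" "inv\<^bsub>sym_group n\<^esub> \<beta> \<in> ?H"
      by (auto intro: generate.inv)
    then have "inv' \<alpha> \<in> ?H" "inv' \<beta> \<in> ?H"
      using alpha_permutes beta_permutes by (simp_all add: sym_group_carrier)
    then show ?thesis
      using that unfolding puzzle_shifts_def by (auto intro: generate.incl)
  qed
  have "word_prod ws \<in> ?H" if "set ws \<subseteq> puzzle_shifts a b" for ws
    using that
  proof (induction ws)
    case Nil
    show ?case
      using generate.one[of "sym_group n"] by (simp only: sym_group_one word_prod_Nil)
  next
    case (Cons g ws)
    then have "g \<in> ?H" "word_prod ws \<in> ?H"
      using gens by auto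
    from generate.eng[OF this] show ?case
      by (simp only: sym_group_mult word_prod_Cons)
  qed
  then show ?thesis
    using assms by (auto simp: word_ball_def carrier_puzzle_group)
qed

lemma carrier_subset_W:
  assumes "p \<in> carrier (puzzle_group a b)"
  shows "\<exists>k. p \<in> W k"
  using assms unfolding carrier_puzzle_group
proof (induction rule: generate.induct)
  case one
  show ?case
    unfolding sym_group_one using id_in_word_ball by blast
next
  case (incl h)
  then show ?case
    using alpha_in_W beta_in_W by auto
next
  case (inv h)
  then have h: "h \<in> W 1"
    using alpha_in_W beta_in_W by auto
  then have "inv\<^bsub>sym_group n\<^esub> h = inv' h"
    using word_ball_permutes by (simp add: sym_group_carrier)
  then show ?case
    using word_ball_inv[OF h] by auto
next
  case (eng h1 h2)
  then show ?case
    unfolding sym_group_mult using word_ball_comp by blast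
qed

lemma carrier_permutes: "p \<in> carrier (puzzle_group a b) \<Longrightarrow> p permutes {1..n}"
  using carrier_subset_W word_ball_permutes by blast

text \<open>The group is finite, so the sum of one radius per element bounds them all. This supplies
  the constant for \<open>a = b = 4\<close>, where \<open>even_in_W\<close> does not apply.\<close>

lemma ex_uniform_word_length:
  "\<exists>K. \<forall>p \<in> carrier (puzzle_group a b). p \<in> W K"
proof -
  let ?C = "carrier (puzzle_group a b)"
  have fin: "finite ?C"
    by (rule finite_subset[OF _ finite_permutations[of "{1..n}"]]) (auto dest: carrier_permutes)
  obtain k where k: "\<forall>p \<in> ?C. p \<in> W (k p)"
    using bchoice[of ?C "\<lambda>p k. p \<in> W k"] carrier_subset_W by blast
  have "p \<in> W (\<Sum>q \<in> ?C. k q)" if "p \<in> ?C" for p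
    using bspec[OF k that] by (rule word_ball_mono) (use member_le_sum[OF that _ fin, of k] in simp)
  then show ?thesis
    by blast
qed

text \<open>Both shifts are even, hence so is every word; the converse inclusion is
  \<open>even_in_W\<close>.\<close>

lemma carrier_eq_alt:
  assumes "odd a" "odd b"
  shows "carrier (puzzle_group a b) = carrier (alt_group n)"
proof -
  have ab: "\<not> (a = 4 \<and> b = 4)"
    using assms by auto
  have even_word: "evenperm (word_prod ws)" if "set ws \<subseteq> puzzle_shifts a b" for ws
    using that
  proof (induction ws)
    case Nil
    show ?case by (simp only: word_prod_Nil evenperm_id)
  next
    case (Cons g ws)
    have perms: "permutation \<alpha>" "permutation \<beta>"
      using alpha_permutes beta_permutes by (auto simp: permutation_permutes)
    have "evenperm g"
      using Cons.prems assms alpha_even_iff beta_even_iff evenperm_inv[OF perms(1)] evenperm_inv[OF perms(2)]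
      unfolding puzzle_shifts_def by auto
    moreover have "permutation g"
      using Cons.prems permutes[of g] by (auto simp: permutation_permutes)
    moreover have "word_prod ws \<in> W (length ws)"
      using Cons.prems by (auto simp: word_ball_def)
    then have "permutation (word_prod ws)"
      using word_ball_permutes by (auto simp: permutation_permutes)
    ultimately show ?case
      using Cons unfolding word_prod_Cons by (subst evenperm_comp) auto
  qed
  show ?thesis
  proof (rule equalityI; rule subsetI)
    fix p
    assume p: "p \<in> carrier (puzzle_group a b)"
    then obtain ws where "p = word_prod ws" "set ws \<subseteq> puzzle_shifts a b"
      using carrier_subset_W by (auto simp: word_ball_def)
    then show "p \<in> carrier (alt_group n)"
      using even_word carrier_permutes[OF p] by (simp add: alt_group_carrier)
  next
    fix p
    assume "p \<in> carrier (alt_group n)"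
    then show "p \<in> carrier (puzzle_group a b)"
      unfolding alt_group_carrier using even_in_W[OF ab] W_subset_carrier by blast
  qed
qed

lemma carrier_eq_sym:
  assumes "\<not> (a = 4 \<and> b = 4)" "\<not> (odd a \<and> odd b)"
  shows "carrier (puzzle_group a b) = carrier (sym_group n)"
proof (rule equalityI; rule subsetI)
  fix p
  assume "p \<in> carrier (puzzle_group a b)"
  then show "p \<in> carrier (sym_group n)"
    unfolding sym_group_carrier by (rule carrier_permutes)
next
  fix p
  assume "p \<in> carrier (sym_group n)"
  then show "p \<in> carrier (puzzle_group a b)"
    unfolding sym_group_carrier by (rule W_subset_carrier[OF perm_in_W[OF assms]])
qed

lemma quadratic_word_length:
  assumes "\<not> (a = 4 \<and> b = 4)" "p \<in> carrier (puzzle_group a b)"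
  shows "p \<in> W (365 * n\<^sup>2)"
proof -
  have "p \<in> W (n * (7 * (12 * n + 40)) + 1)"
  proof (cases "odd a \<and> odd b")
    case True
    then have "p permutes {1..n}" "evenperm p"
      using assms(2) carrier_eq_alt by (auto simp: alt_group_carrier)
    from even_in_W[OF assms(1) this] show ?thesis
      by (rule word_ball_mono) simp
  next
    case False
    then show ?thesis
      using perm_in_W assms carrier_permutes by blast
  qed
  \<comment> \<open>365 is 84 + 280 + 1: the linear and constant terms are absorbed using
    \<open>1 \<le> n\<close>.\<close>
  moreover have "n * (7 * (12 * n + 40)) + 1 \<le> 365 * n\<^sup>2"
  proof -
    have "1 \<le> n"
      using a b by (simp add: puzzle_n_def)
    then have "n \<le> n * n" "1 \<le> n * n"
      by auto
    then have "84 * (n * n) + 280 * n + 1 \<le> 365 * (n * n)"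
      by linarith
    then show ?thesis
      by (simp add: power2_eq_square algebra_simps)
  qed
  ultimately show ?thesis
    by (rule word_ball_mono)
qed

end

section \<open>The exceptional puzzle\<close>

text \<open>The 15 pairs of points are each swapped by exactly one of the five involutions.\<close>

definition synth :: "nat \<Rightarrow> nat \<Rightarrow> nat" where
  "synth c =
    (if c = 1 then transpose 1 3 \<circ> transpose 2 4 \<circ> transpose 5 6
     else if c = 2 then transpose 1 5 \<circ> transpose 2 6 \<circ> transpose 3 4
     else if c = 3 then transpose 1 2 \<circ> transpose 3 5 \<circ> transpose 4 6
     else if c = 4 then transpose 1 4 \<circ> transpose 2 5 \<circ> transpose 3 6
     else transpose 1 6 \<circ> transpose 2 3 \<circ> transpose 4 5)"

lemma set_1_5: "{1..5} = {1, 2, 3, 4, 5::nat}"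
  and set_1_6: "{1..6} = {1, 2, 3, 4, 5, 6::nat}"
  by auto

text \<open>The conjugation action of \<open>p\<close> on the five involutions, written without
  inverses. As a relation it can be propagated through products and inverses before it is known to
  define a map; requiring \<open>q\<close> to be a permutation fixes its values outside the five
  labels.\<close>

definition intertwines :: "(nat \<Rightarrow> nat) \<Rightarrow> (nat \<Rightarrow> nat) \<Rightarrow> bool" where
  "intertwines p q \<longleftrightarrow> q permutes {1..5} \<and> (\<forall>c \<in> {1..5}. p \<circ> synth c = synth (q c) \<circ> p)"

lemma intertwines_id: "intertwines id id"
  unfolding intertwines_def by (intro conjI ballI permutes_id) (simp only: id_comp comp_id id_apply)

lemma intertwines_comp:
  assumes "intertwines p q" "intertwines p' q'"
  shows "intertwines (p \<circ> p') (q \<circ> q')"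
proof -
  have "p \<circ> p' \<circ> synth c = synth ((q \<circ> q') c) \<circ> (p \<circ> p')" if "c \<in> {1..5}" for c
  proof -
    have "q' c \<in> {1..5}"
      using permutes_in_image[of q' "{1..5}" c] assms(2) that unfolding intertwines_def by blast
    then have eq: "p \<circ> synth (q' c) = synth (q (q' c)) \<circ> p"
      using assms(1) unfolding intertwines_def by blast
    have eq': "p' \<circ> synth c = synth (q' c) \<circ> p'"
      using assms(2) that unfolding intertwines_def by blast
    have "p \<circ> p' \<circ> synth c = p \<circ> synth (q' c) \<circ> p'"
      by (simp only: comp_assoc eq')
    also have "\<dots> = synth ((q \<circ> q') c) \<circ> (p \<circ> p')"
      by (subst eq) (simp only: comp_assoc comp_apply)
    finally show ?thesis .
  qed
  moreover have "q \<circ> q' permutes {1..5}"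
    using assms permutes_compose unfolding intertwines_def by blast
  ultimately show ?thesis
    unfolding intertwines_def by blast
qed

lemma intertwines_inv:
  assumes "intertwines p q" "bij p"
  shows "intertwines (inv' p) (inv' q)"
proof -
  have q: "q permutes {1..5}"
    using assms(1) by (simp add: intertwines_def)
  have "inv' p \<circ> synth c = synth (inv' q c) \<circ> inv' p" if "c \<in> {1..5}" for c
  proof
    fix x
    obtain y where y: "x = p y"
      using assms(2) by (metis bij_pointE)
    have "inv' q c \<in> {1..5}"
      using that permutes_in_image[OF permutes_inv[OF q]] by blast
    then have "p (synth (inv' q c) y) = synth c (p y)"
      using assms(1) permutes_inverses(1)[OF q] unfolding intertwines_def by (metis comp_apply)
    then show "(inv' p \<circ> synth c) x = (synth (inv' q c) \<circ> inv' p) x"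
      using bij_is_inj[OF assms(2)] unfolding y comp_apply by (metis inv_f_f)
  qed
  then show ?thesis
    using permutes_inv[OF q] by (simp add: intertwines_def)
qed

text \<open>The five involutions send the point 1 to five different points.\<close>

lemma synth_inj: "inj_on synth {1..5}"
proof -
  have "inj_on (\<lambda>c. synth c 1) {1..5}"
    unfolding set_1_5 by (simp add: synth_def transpose_def)
  then show ?thesis
    by (auto simp: inj_on_def)
qed

lemma intertwines_unique:
  assumes "intertwines p q" "intertwines p q'" "bij p"
  shows "q = q'"
proof
  fix c
  have q: "q permutes {1..5}" "q' permutes {1..5}"
    using assms by (auto simp: intertwines_def)
  show "q c = q' c"
  proof (cases "c \<in> {1..5}")
    case True
    then have "p \<circ> synth c = synth (q c) \<circ> p" "p \<circ> synth c = synth (q' c) \<circ> p"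
      using assms(1,2) unfolding intertwines_def by blast+
    then have eq: "synth (q c) (p y) = synth (q' c) (p y)" for y
      unfolding fun_eq_iff comp_apply by simp
    have "synth (q c) = synth (q' c)"
    proof
      fix x
      show "synth (q c) x = synth (q' c) x"
        using eq[of "inv' p x"] surj_f_inv_f[OF bij_is_surj[OF assms(3)]] by simp
    qed
    moreover have "q c \<in> {1..5}" "q' c \<in> {1..5}"
      using True permutes_in_image[OF q(1), of c] permutes_in_image[OF q(2), of c] by blast+
    ultimately show ?thesis
      using synth_inj by (auto dest: inj_onD)
  next
    case False
    then show ?thesis
      using permutes_not_in[OF q(1) False] permutes_not_in[OF q(2) False] by simp
  qed
qed

text \<open>Faithfulness of the action: \<open>p\<close> commutes with all five involutions, which
  carry 1 to every other point, so \<open>p 1\<close> determines \<open>p\<close> on the six points.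
  Two further commutation relations exclude all values of \<open>p 1\<close> except 1.\<close>

lemma intertwines_id_imp_id:
  assumes "intertwines p id" "p permutes {1..6}"
  shows "p = id"
proof -
  have comm: "p (synth c x) = synth c (p x)" if "c \<in> {1..5}" for c x
    using assms(1) that unfolding intertwines_def by (metis comp_apply id_apply)
  have vals: "p 3 = synth 1 (p 1)" "p 5 = synth 2 (p 1)" "p 2 = synth 3 (p 1)" "p 4 = synth 4 (p 1)"
      "p 6 = synth 5 (p 1)" "p 4 = synth 1 (p 2)" "p 4 = synth 2 (p 3)"
    using comm[of 1 1] comm[of 2 1] comm[of 3 1] comm[of 4 1] comm[of 5 1] comm[of 1 2] comm[of 2 3]
    by (simp_all add: synth_def transpose_def)
  have "p 1 \<in> {1..6}"
    using permutes_in_image[OF assms(2)] by simp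
  then consider "p 1 = 1" | "p 1 = 2" | "p 1 = 3" | "p 1 = 4" | "p 1 = 5" | "p 1 = 6"
    unfolding set_1_6 by blast
  then have "p 1 = 1"
    using vals by cases (simp_all add: synth_def transpose_def)
  then have fixed: "\<forall>x \<in> {1..6}. p x = x"
    using vals unfolding set_1_6 by (simp add: synth_def transpose_def)
  show ?thesis
  proof
    fix x
    show "p x = id x"
      using fixed permutes_not_in[OF assms(2), of x] unfolding id_apply by blast
  qed
qed

text \<open>Relabelling the synthemes by \<alpha> sends number 2 to 4, 4 to 3, 3 to 5 and 5 to 2,
  and preserves number 1.\<close>

lemma intertwines_alpha: "intertwines (puzzle_alpha 4) (cycle_of_list [2, 4, 3, 5])"
proof -
  have "cycle_of_list [2, 4, 3, 5] permutes {1..5::nat}"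
    by (rule permutes_subset[OF cycle_permutes]) auto
  moreover have "puzzle_alpha 4 \<circ> synth c = synth (cycle_of_list [2, 4, 3, 5] c) \<circ> puzzle_alpha 4"
    if "c \<in> {1..5}" for c
  proof
    fix x :: nat
    have "x \<in> {1..6} \<or> x = 0 \<or> 6 < x"
      by auto
    then show "(puzzle_alpha 4 \<circ> synth c) x = (synth (cycle_of_list [2, 4, 3, 5] c) \<circ> puzzle_alpha 4) x"
      using that unfolding set_1_5 set_1_6
      by (elim disjE insertE emptyE) (simp_all add: puzzle_alpha_apply synth_def flip: numeral_2_eq_2)
  qed
  ultimately show ?thesis
    by (simp only: intertwines_def ball_simps) blast
qed

lemma intertwines_beta: "intertwines (puzzle_beta 4 4) (cycle_of_list [1, 4, 2, 5])"
proof -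
  have "cycle_of_list [1, 4, 2, 5] permutes {1..5::nat}"
    by (rule permutes_subset[OF cycle_permutes]) auto
  moreover have "puzzle_beta 4 4 \<circ> synth c = synth (cycle_of_list [1, 4, 2, 5] c) \<circ> puzzle_beta 4 4"
    if "c \<in> {1..5}" for c
  proof
    fix x :: nat
    have "x \<in> {1..6} \<or> x = 0 \<or> 6 < x"
      by auto
    then show "(puzzle_beta 4 4 \<circ> synth c) x = (synth (cycle_of_list [1, 4, 2, 5] c) \<circ> puzzle_beta 4 4) x"
      using that unfolding set_1_5 set_1_6
      by (elim disjE insertE emptyE) (simp_all add: puzzle_beta_apply puzzle_n_def synth_def)
  qed
  ultimately show ?thesis
    by (simp only: intertwines_def ball_simps) blast
qed

text \<open>With the next lemma, this expresses the 5-cycle and the transposition of the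
  \<open>(2, 5)\<close>-puzzle through the images of the two shifts.\<close>

lemma puzzle_beta_2_5: "cycle_of_list [2, 4, 3, 5] \<circ> puzzle_beta 2 5 = cycle_of_list [1, 4, 2, 5]"
proof
  fix x :: nat
  have "x \<in> {1..5} \<or> x = 0 \<or> 5 < x"
    by auto
  then show "(cycle_of_list [2, 4, 3, 5] \<circ> puzzle_beta 2 5) x = cycle_of_list [1, 4, 2, 5] x"
    unfolding set_1_5 by (elim disjE insertE emptyE) (simp_all add: puzzle_beta_apply puzzle_n_def flip: numeral_2_eq_2)
qed

lemma puzzle_alpha_2:
  "puzzle_alpha 2 = cycle_of_list [2, 4, 3, 5] \<circ> cycle_of_list [1, 4, 2, 5] \<circ> puzzle_beta 2 5
    \<circ> cycle_of_list [2, 4, 3, 5]"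
proof
  fix x :: nat
  have "x \<in> {1..5} \<or> x = 0 \<or> 5 < x"
    by auto
  then show "puzzle_alpha 2 x = (cycle_of_list [2, 4, 3, 5] \<circ> cycle_of_list [1, 4, 2, 5] \<circ> puzzle_beta 2 5
    \<circ> cycle_of_list [2, 4, 3, 5]) x"
    unfolding set_1_5 by (elim disjE insertE emptyE)
      (simp_all add: puzzle_alpha_apply puzzle_beta_apply puzzle_n_def flip: numeral_2_eq_2)
qed

text \<open>Surjectivity: the permutations that lift to words of the \<open>(4, 4)\<close>-puzzle
  are closed under products and inverses and contain both generators of the
  \<open>(2, 5)\<close>-puzzle. That puzzle generates all of S_5 by \<open>perm_in_W\<close>, since
  2 is even.\<close>

lemma every_perm_5_intertwined:
  assumes "q permutes {1..5}"
  shows "\<exists>p \<in> carrier (puzzle_group 4 4). intertwines p q"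
proof -
  interpret P: puzzle 4 4 by unfold_locales auto
  interpret Q: puzzle 2 5 by unfold_locales auto
  define R where "R q \<longleftrightarrow> (\<exists>k. \<exists>p \<in> P.W k. intertwines p q)" for q
  have R_comp: "R (q \<circ> q')" if "R q" "R q'" for q q'
    using that word_ball_comp intertwines_comp unfolding R_def by blast
  have R_inv: "R (inv' q)" if "R q" for q
    using that P.word_ball_inv P.word_ball_bij intertwines_inv unfolding R_def by blast
  have R_id: "R id"
    using id_in_word_ball intertwines_id unfolding R_def by blast
  let ?a = "cycle_of_list [2, 4, 3, 5] :: nat \<Rightarrow> nat" and ?b = "cycle_of_list [1, 4, 2, 5] :: nat \<Rightarrow> nat"
  have Ra: "R ?a" and Rb: "R ?b"
    using P.alpha_in_W P.beta_in_W intertwines_alpha intertwines_beta unfolding R_def by blast+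
  have "inv' ?a \<circ> ?a = id"
    by (rule permutes_inv_o(2)[OF cycle_permutes])
  then have "Q.\<beta> = inv' ?a \<circ> ?b"
    by (simp only: puzzle_beta_2_5[symmetric] comp_assoc[symmetric] id_comp)
  then have Rbeta: "R Q.\<beta>"
    using R_comp[OF R_inv[OF Ra] Rb] by (simp only:)
  then have "R Q.\<alpha>"
    unfolding puzzle_alpha_2 by (intro R_comp Ra Rb)
  then have gens: "R g" if "g \<in> puzzle_shifts 2 5" for g
    using that Rbeta R_inv unfolding puzzle_shifts_def by blast
  have words: "R (word_prod ws)" if "set ws \<subseteq> puzzle_shifts 2 5" for ws
    using that
  proof (induction ws)
    case Nil
    show ?case using R_id by (simp only: word_prod_Nil)
  next
    case (Cons g ws)
    then have "R g" "R (word_prod ws)"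
      using gens by auto
    then show ?case
      unfolding word_prod_Cons by (rule R_comp)
  qed
  have "q permutes {1..Q.n}"
    using assms by (simp add: puzzle_n_def)
  from Q.perm_in_W[OF _ _ this] obtain ws where "q = word_prod ws" "set ws \<subseteq> puzzle_shifts 2 5"
    by (auto simp: word_ball_def)
  then have "R q"
    using words by simp
  then show ?thesis
    using P.W_subset_carrier unfolding R_def by blast
qed

lemma carrier_4_4_intertwines:
  assumes "p \<in> carrier (puzzle_group 4 4)"
  shows "\<exists>q. intertwines p q"
proof -
  interpret P: puzzle 4 4 by unfold_locales auto
  have gens: "bij g \<and> (\<exists>q. intertwines g q)" if "g \<in> puzzle_shifts 4 4" for g
    using that intertwines_alpha intertwines_beta P.alpha_bij P.beta_bij
      intertwines_inv bij_imp_bij_inv unfolding puzzle_shifts_def by blast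
  have "\<exists>q. intertwines (word_prod ws) q" if "set ws \<subseteq> puzzle_shifts 4 4" for ws
    using that
  proof (induction ws)
    case Nil
    show ?case
      unfolding word_prod_Nil using intertwines_id by blast
  next
    case (Cons g ws)
    then have "\<exists>q. intertwines g q" "\<exists>q. intertwines (word_prod ws) q"
      using gens by auto
    then show ?case
      unfolding word_prod_Cons using intertwines_comp by blast
  qed
  moreover obtain ws where "p = word_prod ws" "set ws \<subseteq> puzzle_shifts 4 4"
    using P.carrier_subset_W[OF assms] by (auto simp: word_ball_def)
  ultimately show ?thesis
    by blast
qed

lemma puzzle_group_4_4: "puzzle_group 4 4 \<cong> sym_group 5"
proof -
  interpret P: puzzle 4 4 by unfold_locales auto
  let ?G = "puzzle_group 4 4"
  \<comment> \<open>The choice is unambiguous on the group by \<open>intertwines_unique\<close>,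
    which also yields multiplicativity.\<close>
  define \<phi> where "\<phi> p = (SOME q. intertwines p q)" for p
  have \<phi>: "intertwines p (\<phi> p)" if "p \<in> carrier ?G" for p
    unfolding \<phi>_def using carrier_4_4_intertwines[OF that] by (rule someI_ex)
  have bij: "bij p" if "p \<in> carrier ?G" for p
    using P.carrier_permutes[OF that] by (rule permutes_bij)
  have \<phi>_eq: "\<phi> p = q" if "p \<in> carrier ?G" "intertwines p q" for p q
    using intertwines_unique[OF \<phi>[OF that(1)] that(2) bij[OF that(1)]] .
  have closed: "p \<circ> p' \<in> carrier ?G" if pp: "p \<in> carrier ?G" "p' \<in> carrier ?G" for p p'
    using P.carrier_subset_W[OF pp(1)] P.carrier_subset_W[OF pp(2)] word_ball_comp P.W_subset_carrier
    by blast
  have inv_closed: "inv' p \<in> carrier ?G" if p: "p \<in> carrier ?G" for p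
    using P.carrier_subset_W[OF p] P.word_ball_inv P.W_subset_carrier by blast
  have hom: "\<phi> \<in> hom ?G (sym_group 5)"
  proof (rule homI)
    fix p
    assume p: "p \<in> carrier ?G"
    show "\<phi> p \<in> carrier (sym_group 5)"
      using \<phi>[OF p] unfolding sym_group_carrier intertwines_def by blast
    fix p'
    assume p': "p' \<in> carrier ?G"
    show "\<phi> (p \<otimes>\<^bsub>?G\<^esub> p') = \<phi> p \<otimes>\<^bsub>sym_group 5\<^esub> \<phi> p'"
      unfolding puzzle_group_def mult_subgroup_generated sym_group_mult
      using \<phi>_eq[OF closed[OF p p'] intertwines_comp[OF \<phi>[OF p] \<phi>[OF p']]] .
  qed
  have "inj_on \<phi> (carrier ?G)"
  proof (rule inj_onI)
    fix p p'
    assume p: "p \<in> carrier ?G" and p': "p' \<in> carrier ?G" and eq: "\<phi> p = \<phi> p'"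
    have "\<phi> p permutes {1..5}"
      using \<phi>[OF p] unfolding intertwines_def by blast
    then have "inv' (\<phi> p) \<circ> \<phi> p' = id"
      unfolding eq by (rule permutes_inv_o(2))
    \<comment> \<open>Equal images put \<open>inv' p \<circ> p'\<close> into the kernel, which
      faithfulness shows to be trivial.\<close>
    then have "intertwines (inv' p \<circ> p') id"
      using intertwines_comp[OF intertwines_inv[OF \<phi>[OF p] bij[OF p]] \<phi>[OF p']] by (simp only:)
    moreover have "inv' p \<circ> p' permutes {1..6}"
      using P.carrier_permutes[OF closed[OF inv_closed[OF p] p']] by (simp add: puzzle_n_def)
    ultimately have "inv' p \<circ> p' = id"
      by (rule intertwines_id_imp_id)
    then have "p \<circ> inv' p \<circ> p' = p"
      by (simp only: comp_assoc comp_id)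
    moreover have "p \<circ> inv' p = id"
      using bij_is_surj[OF bij[OF p]] by (simp only: surj_iff)
    ultimately show "p = p'"
      by (simp only: id_comp)
  qed
  moreover have "\<phi> ` carrier ?G = carrier (sym_group 5)"
  proof
    show "\<phi> ` carrier ?G \<subseteq> carrier (sym_group 5)"
      using hom by (auto simp: hom_def)
    show "carrier (sym_group 5) \<subseteq> \<phi> ` carrier ?G"
    proof
      fix q
      assume "q \<in> carrier (sym_group 5)"
      then obtain p where "p \<in> carrier ?G" "intertwines p q"
        using every_perm_5_intertwined unfolding sym_group_carrier by blast
      then show "q \<in> \<phi> ` carrier ?G"
        using \<phi>_eq by blast
    qed
  qed
  ultimately show ?thesis
    using hom by (auto simp: is_iso_def iso_def bij_betw_def)
qed

section \<open>Classification and uniform quadratic bound\<close>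

theorem theorem2:
  shows "(\<forall>a b :: nat. 1 < a \<longrightarrow> 1 < b \<longrightarrow>
            (a = 4 \<and> b = 4 \<longrightarrow> puzzle_group a b \<cong> sym_group (puzzle_n a b - 1)) \<and>
            (odd a \<and> odd b \<longrightarrow> carrier (puzzle_group a b) = carrier (alt_group (puzzle_n a b))) \<and>
            (\<not> (a = 4 \<and> b = 4) \<and> \<not> (odd a \<and> odd b) \<longrightarrow>
               carrier (puzzle_group a b) = carrier (sym_group (puzzle_n a b))))
       \<and> (\<exists>K :: nat. \<forall>a b :: nat. 1 < a \<longrightarrow> 1 < b \<longrightarrow>
            (\<forall>p \<in> carrier (puzzle_group a b). \<exists>ws.
               set ws \<subseteq> puzzle_shifts a b \<and> length ws \<le> K * (puzzle_n a b)^2 \<and> p = word_prod ws))"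
proof (intro conjI allI impI)
  fix a b :: nat
  assume "1 < a" "1 < b"
  then interpret puzzle a b by unfold_locales
  show "puzzle_group a b \<cong> sym_group (puzzle_n a b - 1)" if "a = 4 \<and> b = 4"
    using puzzle_group_4_4 that by (simp add: puzzle_n_def)
  show "carrier (puzzle_group a b) = carrier (alt_group (puzzle_n a b))" if "odd a \<and> odd b"
    using carrier_eq_alt that by blast
  show "carrier (puzzle_group a b) = carrier (sym_group (puzzle_n a b))"
    if "\<not> (a = 4 \<and> b = 4) \<and> \<not> (odd a \<and> odd b)"
    using carrier_eq_sym that by blast
next
  interpret P: puzzle 4 4 by unfold_locales auto
  obtain K where K: "\<forall>p \<in> carrier (puzzle_group 4 4). p \<in> word_ball (puzzle_shifts 4 4) K"
    using P.ex_uniform_word_length by blast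
  \<comment> \<open>The sum \<open>365 + K\<close> serves both the general bound and the single
    exceptional group, whose \<open>n\<close> is 6.\<close>
  have "p \<in> word_ball (puzzle_shifts a b) ((365 + K) * (puzzle_n a b)\<^sup>2)"
    if ab: "1 < a" "1 < b" and p: "p \<in> carrier (puzzle_group a b)" for a b p
  proof -
    interpret puzzle a b using ab by unfold_locales
    show ?thesis
    proof (cases "a = 4 \<and> b = 4")
      case True
      then have "p \<in> W K"
        using K p by blast
      then show ?thesis
        by (rule word_ball_mono) (use True in \<open>simp add: puzzle_n_def\<close>)
    next
      case False
      from quadratic_word_length[OF this p] show ?thesis
        by (rule word_ball_mono) (simp add: algebra_simps)
    qed
  qed
  then show "\<exists>K :: nat. \<forall>a b :: nat. 1 < a \<longrightarrow> 1 < b \<longrightarrow>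
      (\<forall>p \<in> carrier (puzzle_group a b). \<exists>ws.
        set ws \<subseteq> puzzle_shifts a b \<and> length ws \<le> K * (puzzle_n a b)^2 \<and> p = word_prod ws)"
    unfolding word_ball_def by blast
qed

end
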